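(* Let $D$ be an integral domain and let $\tau$ be a relation on $D^{\#}$ such that $\tau^2\neq\emptyset$, where $\tau^2=\tau\circ\tau$. (1) If $\tau$ is reflexive, then $\tau^2$ is reflexive. (2) If $\tau$ is symmetric, then $id_{Coim(\tau)\cup Im(\tau)}\subseteq\tau^2$ and $\tau^2$ is symmetric. (3) If $\tau$ is transitive, then $\tau^2\subseteq\tau$ and $\tau^2$ is transitive. (4) If $\tau$ is an equivalence relation, then $\tau^2$ is an equivalence relation. (5) If $\tau$ is a partial order, then $\tau^2$ is a partial order.
   Context: For an integral domain $D$, $D^{\#}$ denotes the set of nonzero nonunit elements of $D$. A relation on $D^{\#}$ is a subset of $D^{\#}\times D^{\#}$. Composition is defined by: $a\,(R_1\circ R_2)\,b$ if and only if there exists $c\in D^{\#}$ such that $a\,R_2\,c$ and $c\,R_1\,b$. For a relation $R$ on $D^{\#}$, $Coim(R)=\{a\in D^{\#}:\exists b\in D^{\#},\ (a,b)\in R\}$ and $Im(R)=\{b\in D^{\#}:\exists a\in D^{\#},\ (a,b)\in R\}$. For $S\subseteq D^{\#}$, $id_S=\{(a,a):a\in S\}$. Reflexive means reflexive on $D^{\#}$; a partial order is a reflexive, antisymmetric, transitive relation on $D^{\#}$. *)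

theory Defs
  imports "HOL-Algebra.Ring"
begin

definition nonzero_nonunits :: "('a, 'm) ring_scheme \<Rightarrow> 'a set"
  where "nonzero_nonunits D = carrier D - {\<zero>\<^bsub>D\<^esub>} - Units D"

text \<open>Composition in functional order, so the arguments of the library's \<^const>\<open>relcomp\<close>
  are swapped. For relations on \<open>S\<close> the intermediate element is automatically in \<open>S\<close>.
  The coimage, the image and the identity on \<open>S\<close> are the library's \<^const>\<open>Domain\<close>,
  \<^const>\<open>Range\<close> and \<^const>\<open>Id_on\<close>.\<close>

definition rel_comp :: "'a rel \<Rightarrow> 'a rel \<Rightarrow> 'a rel"  (infixr \<open>\<circ>\<^sub>R\<close> 75)
  where "R\<^sub>1 \<circ>\<^sub>R R\<^sub>2 = R\<^sub>2 O R\<^sub>1"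

lemma rel_comp_iff:
  assumes "R\<^sub>1 \<subseteq> S \<times> S" and "R\<^sub>2 \<subseteq> S \<times> S"
  shows "(a, b) \<in> R\<^sub>1 \<circ>\<^sub>R R\<^sub>2 \<longleftrightarrow> (\<exists>c\<in>S. (a, c) \<in> R\<^sub>2 \<and> (c, b) \<in> R\<^sub>1)"
  using assms unfolding rel_comp_def by blast

end

theory Submission
  imports Defs
begin

text \<open>Everything takes place at the level of relations on a fixed set. Composing a pair with a
  loop at one of its ends gives back that pair, so for a reflexive relation \<open>\<tau> \<subseteq> \<tau>\<^sup>2\<close>, while
  transitivity says precisely that \<open>\<tau>\<^sup>2 \<subseteq> \<tau>\<close>. A preorder is therefore idempotent under
  composition, and for equivalence relations and partial orders passing to the square changes
  nothing at all. In the symmetric case every pair can be traversed forth and back, which yields a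
  loop in \<open>\<tau>\<^sup>2\<close> at each of its ends.\<close>

lemma refl_on_rel_comp:
  assumes "refl_on S R" and "refl_on S R'"
  shows "refl_on S (R \<circ>\<^sub>R R')"
  using assms unfolding refl_on_def rel_comp_def by blast

lemma sym_imp_Id_on_subset_rel_comp_self:
  assumes "sym R"
  shows "Id_on (Domain R \<union> Range R) \<subseteq> R \<circ>\<^sub>R R"
  using assms unfolding rel_comp_def by (blast dest: symD)

lemma sym_rel_comp_self:
  assumes "sym R"
  shows "sym (R \<circ>\<^sub>R R)"
  using assms unfolding rel_comp_def sym_def by blast

lemma trans_imp_rel_comp_self_subset:
  assumes "trans R"
  shows "R \<circ>\<^sub>R R \<subseteq> R"
  using assms unfolding rel_comp_def by (rule trans_O_subset)

text \<open>The two factors of a composable pair in \<open>R\<^sup>2\<close> lie in \<open>R\<close> by transitivity, and their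
  composite is then in \<open>R\<^sup>2\<close> by definition.\<close>

lemma trans_rel_comp_self:
  assumes "trans R"
  shows "trans (R \<circ>\<^sub>R R)"
proof (rule transI)
  fix a b c
  assume "(a, b) \<in> R \<circ>\<^sub>R R" and "(b, c) \<in> R \<circ>\<^sub>R R"
  then have "(a, b) \<in> R" and "(b, c) \<in> R"
    using trans_imp_rel_comp_self_subset[OF assms] by blast+
  then show "(a, c) \<in> R \<circ>\<^sub>R R"
    unfolding rel_comp_def by blast
qed

lemma preorder_rel_comp_self:
  assumes "R \<subseteq> S \<times> S" and "refl_on S R" and "trans R"
  shows "R \<circ>\<^sub>R R = R"
proof
  show "R \<circ>\<^sub>R R \<subseteq> R"
    using assms(3) by (rule trans_imp_rel_comp_self_subset)
  show "R \<subseteq> R \<circ>\<^sub>R R"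
    using assms(1,2) unfolding refl_on_def rel_comp_def by blast
qed

theorem mainTheorem4:
  fixes D :: "('a, 'm) ring_scheme" and \<tau> :: "'a rel"
  assumes "domain D"
    and "\<tau> \<subseteq> nonzero_nonunits D \<times> nonzero_nonunits D"
    and "\<tau> \<circ>\<^sub>R \<tau> \<noteq> {}"
  shows "(refl_on (nonzero_nonunits D) \<tau> \<longrightarrow> refl_on (nonzero_nonunits D) (\<tau> \<circ>\<^sub>R \<tau>)) \<and>
    (sym \<tau> \<longrightarrow> Id_on (Domain \<tau> \<union> Range \<tau>) \<subseteq> \<tau> \<circ>\<^sub>R \<tau> \<and> sym (\<tau> \<circ>\<^sub>R \<tau>)) \<and>
    (trans \<tau> \<longrightarrow> \<tau> \<circ>\<^sub>R \<tau> \<subseteq> \<tau> \<and> trans (\<tau> \<circ>\<^sub>R \<tau>)) \<and>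
    (equiv (nonzero_nonunits D) \<tau> \<longrightarrow> equiv (nonzero_nonunits D) (\<tau> \<circ>\<^sub>R \<tau>)) \<and>
    (partial_order_on (nonzero_nonunits D) \<tau> \<longrightarrow>
      partial_order_on (nonzero_nonunits D) (\<tau> \<circ>\<^sub>R \<tau>))"
proof (intro conjI impI)
  note idem = preorder_rel_comp_self[OF assms(2)]
  show "refl_on (nonzero_nonunits D) (\<tau> \<circ>\<^sub>R \<tau>)" if "refl_on (nonzero_nonunits D) \<tau>"
    using that that by (rule refl_on_rel_comp)
  show "Id_on (Domain \<tau> \<union> Range \<tau>) \<subseteq> \<tau> \<circ>\<^sub>R \<tau>" if "sym \<tau>"
    using that by (rule sym_imp_Id_on_subset_rel_comp_self)
  show "sym (\<tau> \<circ>\<^sub>R \<tau>)" if "sym \<tau>"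
    using that by (rule sym_rel_comp_self)
  show "\<tau> \<circ>\<^sub>R \<tau> \<subseteq> \<tau>" if "trans \<tau>"
    using that by (rule trans_imp_rel_comp_self_subset)
  show "trans (\<tau> \<circ>\<^sub>R \<tau>)" if "trans \<tau>"
    using that by (rule trans_rel_comp_self)
  show "equiv (nonzero_nonunits D) (\<tau> \<circ>\<^sub>R \<tau>)" if "equiv (nonzero_nonunits D) \<tau>"
    using that idem by (simp add: equiv_def)
  show "partial_order_on (nonzero_nonunits D) (\<tau> \<circ>\<^sub>R \<tau>)"
    if "partial_order_on (nonzero_nonunits D) \<tau>"
    using that idem by (simp add: partial_order_on_def preorder_on_def)
qed

end
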